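(* Let $\ell_1,\ell_2\ge 1$ be integers, let $\mathscr{M}=\{(a,b)\in\mathbb{Z}^2: 0\le a\le \ell_1-1,\ 0\le b\le \ell_2-1\}$ with the componentwise order, and let $\mathrm{wt}$ be a rank increasing and rank constant weight function on $\mathscr{M}$. If $A\subseteq\mathscr{M}$ is an optimal downset, then one of the following holds: (T.1) $A$ is the initial segment of size $|A|$ of a domination order, i.e. of $\mathcal{L}$ or of $\mathcal{C}$; (T.2) there exist a domination order $\mathcal{D}\in\{\mathcal{L},\mathcal{C}\}$, a packed poset $\mathscr{Q}\subseteq\mathscr{M}$ and coordinates $c_1,c_2\in\{1,2\}$ such that $A=\mathrm{Sym}(\mathscr{Q},I,c_1,c_2)$, where $I$ is the initial segment of size $|A|$ of $\mathcal{D}$.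
   Context: A downset is a subset $A$ with: $x\le y$, $y\in A$ implies $x\in A$. The rank of $(a,b)$ is $a+b$; $\mathrm{wt}$ is rank constant if equal ranks give equal weights, and rank increasing if strictly smaller rank gives strictly smaller weight. $\mathrm{wt}(S)=\sum_{s\in S}\mathrm{wt}(s)$. A downset $A$ is optimal if $\mathrm{wt}(A)\ge\mathrm{wt}(S)$ for every downset $S$ with $|S|=|A|$. The lexicographic order $\mathcal{L}$: $(a,b)<_{\mathcal{L}}(c,d)$ iff $a<c$, or $a=c$ and $b<d$. The colexicographic order $\mathcal{C}$: $(a,b)<_{\mathcal{C}}(c,d)$ iff $b<d$, or $b=d$ and $a<c$. These are the two domination orders. The initial segment of size $m$ of a total order is the set of its $m$ smallest elements. A packed poset is a set $\mathscr{Q}=\{(a,b): s_1\le a\le t_1,\ s_2\le b\le t_2\}\subseteq\mathscr{M}$. Symmetrization: for $c_1=c_2$, $\mathrm{Sym}(\mathscr{Q},A,c_1,c_2)=A$. For $\{c_1,c_2\}=\{1,2\}$ one requires $t_1-s_1=t_2-s_2$; define the reflection $\rho(a,b)=(s_1+b-s_2,\ s_2+a-s_1)$ on $\mathscr{Q}$, local coordinates $u_1=a-s_1$, $u_2=b-s_2$ of $f=(a,b)\in\mathscr{Q}$, and $f_{(c_1,c_2)}=\rho(f)$ if $u_{c_1}<u_{c_2}$ and $f_{(c_1,c_2)}=f$ otherwise. Then $\mathrm{Sym}(\mathscr{Q},A,c_1,c_2)=(A\setminus\mathscr{Q})\cup\{f\in A\cap\mathscr{Q}:\rho(f)\in A\}\cup\{f_{(c_1,c_2)}: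 f\in A\cap\mathscr{Q}\}$. *)

theory Defs
  imports Complex_Main "HOL-Library.Product_Order"
begin

text \<open>The order \<open>\<le>\<close> on pairs is the componentwise one of \<open>HOL-Library.Product_Order\<close>.\<close>

definition grid :: "int \<Rightarrow> int \<Rightarrow> (int \<times> int) set" where
  "grid l1 l2 = {(a, b). 0 \<le> a \<and> a \<le> l1 - 1 \<and> 0 \<le> b \<and> b \<le> l2 - 1}"

definition downset :: "(int \<times> int) set \<Rightarrow> (int \<times> int) set \<Rightarrow> bool" where
  "downset M A \<longleftrightarrow> A \<subseteq> M \<and> (\<forall>x\<in>M. \<forall>y\<in>A. x \<le> y \<longrightarrow> x \<in> A)"

definition pair_rank :: "int \<times> int \<Rightarrow> int" where
  "pair_rank x = fst x + snd x"

definition rank_constant :: "(int \<times> int) set \<Rightarrow> (int \<times> int \<Rightarrow> real) \<Rightarrow> bool" where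
  "rank_constant M wt \<longleftrightarrow> (\<forall>x\<in>M. \<forall>y\<in>M. pair_rank x = pair_rank y \<longrightarrow> wt x = wt y)"

definition rank_increasing :: "(int \<times> int) set \<Rightarrow> (int \<times> int \<Rightarrow> real) \<Rightarrow> bool" where
  "rank_increasing M wt \<longleftrightarrow> (\<forall>x\<in>M. \<forall>y\<in>M. pair_rank x < pair_rank y \<longrightarrow> wt x < wt y)"

definition optimal_downset ::
    "(int \<times> int) set \<Rightarrow> (int \<times> int \<Rightarrow> real) \<Rightarrow> (int \<times> int) set \<Rightarrow> bool" where
  "optimal_downset M wt A \<longleftrightarrow>
     downset M A \<and> (\<forall>S. downset M S \<and> card S = card A \<longrightarrow> sum wt S \<le> sum wt A)"

definition lex_less :: "int \<times> int \<Rightarrow> int \<times> int \<Rightarrow> bool" where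
  "lex_less x y \<longleftrightarrow> fst x < fst y \<or> fst x = fst y \<and> snd x < snd y"

definition colex_less :: "int \<times> int \<Rightarrow> int \<times> int \<Rightarrow> bool" where
  "colex_less x y \<longleftrightarrow> snd x < snd y \<or> snd x = snd y \<and> fst x < fst y"

definition domination_orders :: "(int \<times> int \<Rightarrow> int \<times> int \<Rightarrow> bool) set" where
  "domination_orders = {lex_less, colex_less}"

text \<open>For a strict total order \<open>D\<close> on a finite set \<open>M\<close>, an element is among the \<open>m\<close> smallest
  ones iff fewer than \<open>m\<close> elements of \<open>M\<close> precede it.\<close>

definition initial_segment ::
    "(int \<times> int) set \<Rightarrow> (int \<times> int \<Rightarrow> int \<times> int \<Rightarrow> bool) \<Rightarrow> nat \<Rightarrow> (int \<times> int) set" where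
  "initial_segment M D m = {x \<in> M. card {y \<in> M. D y x} < m}"

definition packed :: "int \<Rightarrow> int \<Rightarrow> int \<Rightarrow> int \<Rightarrow> (int \<times> int) set" where
  "packed s1 t1 s2 t2 = {(a, b). s1 \<le> a \<and> a \<le> t1 \<and> s2 \<le> b \<and> b \<le> t2}"

definition reflection :: "int \<Rightarrow> int \<Rightarrow> int \<times> int \<Rightarrow> int \<times> int" where
  "reflection s1 s2 f = (s1 + snd f - s2, s2 + fst f - s1)"

text \<open>Coordinates are indexed by the naturals 1 and 2.\<close>

definition local_coord :: "int \<Rightarrow> int \<Rightarrow> nat \<Rightarrow> int \<times> int \<Rightarrow> int" where
  "local_coord s1 s2 c f = (if c = 1 then fst f - s1 else snd f - s2)"

definition sym_elem :: "int \<Rightarrow> int \<Rightarrow> nat \<Rightarrow> nat \<Rightarrow> int \<times> int \<Rightarrow> int \<times> int" where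
  "sym_elem s1 s2 c1 c2 f =
     (if local_coord s1 s2 c1 f < local_coord s1 s2 c2 f then reflection s1 s2 f else f)"

text \<open>The packed poset is passed by its bounds. For \<open>c1 \<noteq> c2\<close> the operation is meant only for
  squares, \<open>t1 - s1 = t2 - s2\<close>; this is a side condition wherever it is used.\<close>

definition Sym ::
    "int \<Rightarrow> int \<Rightarrow> int \<Rightarrow> int \<Rightarrow> (int \<times> int) set \<Rightarrow> nat \<Rightarrow> nat \<Rightarrow> (int \<times> int) set" where
  "Sym s1 t1 s2 t2 A c1 c2 =
     (if c1 = c2 then A
      else (A - packed s1 t1 s2 t2)
           \<union> {f \<in> A \<inter> packed s1 t1 s2 t2. reflection s1 s2 f \<in> A}
           \<union> sym_elem s1 s2 c1 c2 ` (A \<inter> packed s1 t1 s2 t2))"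

end

theory Submission
  imports Defs "HOL-Library.FuncSet"
begin

text \<open>
  A rank-preserving injection between downsets preserves optimality, and one that raises a rank
  contradicts it. Two such maps suffice: reflecting the square \<open>[s, s + d] \<times> [t, t + d]\<close>, and
  exchanging one removable cell for one addable cell. Up to exchanging the coordinates, the optimal
  downsets turn out to be contained in three families: full rows followed by part of a row
  (an initial segment of the colexicographic order), full rows with part of the first column on
  top, and full rows whose last column lacks some top cells; the latter two arise from the first by
  symmetrizing in one square. The proof is by induction on \<open>l + n\<close>. Reversing and complementing
  a downset and exchanging the coordinates preserve optimality and the families, so one may assume
  that the bottom row is full. Deleting it leaves an optimal downset of the smaller grid. If that
  one is of row type, so is the whole downset. If it is of column type, a reflection turns it into
  full columns followed by part of a column, and for a full bottom row below such a set there is an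
  improving exchange outside the claimed families.
\<close>

subsection \<open>Weight-free optimality\<close>

text \<open>The weight is quantified away because exchanging coordinates, complementing and deleting
  a row each call for a new weight, possibly on another grid.\<close>

definition optimal_for_some_weight :: "int \<Rightarrow> int \<Rightarrow> (int \<times> int) set \<Rightarrow> bool" where
  "optimal_for_some_weight l n A \<longleftrightarrow>
     (\<exists>wt. rank_increasing (grid l n) wt \<and> rank_constant (grid l n) wt \<and>
           optimal_downset (grid l n) wt A)"

text \<open>A uniform rank shift preserves comparisons of ranks. The shift \<open>c\<close> is 0 for
  exchanging coordinates and 1 for moving up one row.\<close>

lemma rank_increasing_pullback:
  assumes "rank_increasing M wt" "\<And>x. x \<in> N \<Longrightarrow> g x \<in> M"
    and "\<And>x. x \<in> N \<Longrightarrow> pair_rank (g x) = pair_rank x + c"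
  shows "rank_increasing N (wt \<circ> g)"
  unfolding rank_increasing_def
proof (intro ballI impI)
  fix x y assume "x \<in> N" "y \<in> N" "pair_rank x < pair_rank y"
  then show "(wt \<circ> g) x < (wt \<circ> g) y"
    using assms(1)[unfolded rank_increasing_def, rule_format, of "g x" "g y"] assms(2,3) by simp
qed

lemma rank_constant_pullback:
  assumes "rank_constant M wt" "\<And>x. x \<in> N \<Longrightarrow> g x \<in> M"
    and "\<And>x. x \<in> N \<Longrightarrow> pair_rank (g x) = pair_rank x + c"
  shows "rank_constant N (wt \<circ> g)"
  unfolding rank_constant_def
proof (intro ballI impI)
  fix x y assume "x \<in> N" "y \<in> N" "pair_rank x = pair_rank y"
  then show "(wt \<circ> g) x = (wt \<circ> g) y"
    using assms(1)[unfolded rank_constant_def, rule_format, of "g x" "g y"] assms(2,3) by simp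
qed

lemma downset_subset: "downset M A \<Longrightarrow> A \<subseteq> M"
  by (simp add: downset_def)

lemma mem_grid [simp]: "(a, b) \<in> grid l n \<longleftrightarrow> 0 \<le> a \<and> a < l \<and> 0 \<le> b \<and> b < n"
  by (auto simp: grid_def)

lemma finite_grid [simp]: "finite (grid l n)"
proof -
  have "grid l n = {0..l - 1} \<times> {0..n - 1}"
    by (auto simp: grid_def)
  then show ?thesis
    by simp
qed

lemma downset_grid_iff:
  "downset (grid l n) A \<longleftrightarrow> A \<subseteq> grid l n \<and>
     (\<forall>a b c d. (c, d) \<in> A \<longrightarrow> 0 \<le> a \<longrightarrow> a \<le> c \<longrightarrow> 0 \<le> b \<longrightarrow> b \<le> d \<longrightarrow> (a, b) \<in> A)"
proof -
  have "(\<forall>x\<in>grid l n. \<forall>y\<in>A. x \<le> y \<longrightarrow> x \<in> A) \<longleftrightarrow>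
     (\<forall>a b c d. (c, d) \<in> A \<longrightarrow> 0 \<le> a \<longrightarrow> a \<le> c \<longrightarrow> 0 \<le> b \<longrightarrow> b \<le> d \<longrightarrow> (a, b) \<in> A)"
    (is "?L \<longleftrightarrow> ?R") if "A \<subseteq> grid l n"
  proof
    assume L: ?L
    show ?R
    proof (intro allI impI)
      fix a b c d :: int
      assume *: "(c, d) \<in> A" "0 \<le> a" "a \<le> c" "0 \<le> b" "b \<le> d"
      then have "(c, d) \<in> grid l n"
        using that by blast
      then have "(a, b) \<in> grid l n" "(a, b) \<le> (c, d)"
        using * by auto
      then show "(a, b) \<in> A"
        using L *(1) by blast
    qed
  next
    assume R: ?R
    show ?L
    proof (intro ballI impI)
      fix x y assume "x \<in> grid l n" "y \<in> A" "x \<le> y"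
      then show "x \<in> A"
        using R by (cases x; cases y) auto
    qed
  qed
  then show ?thesis
    unfolding downset_def by (rule conj_cong[OF refl])
qed

lemma downset_gridI:
  assumes "\<And>c d. (c, d) \<in> A \<Longrightarrow> 0 \<le> c \<and> c < l \<and> 0 \<le> d \<and> d < n"
    and "\<And>a b c d. \<lbrakk>(c, d) \<in> A; 0 \<le> a; a \<le> c; 0 \<le> b; b \<le> d\<rbrakk> \<Longrightarrow> (a, b) \<in> A"
  shows "downset (grid l n) A"
  unfolding downset_grid_iff
proof (intro conjI allI impI)
  show "A \<subseteq> grid l n"
    using assms(1) by (auto simp: grid_def)
qed (rule assms(2))

lemma downset_gridD:
  assumes "downset (grid l n) A" "(c, d) \<in> A" "0 \<le> a" "a \<le> c" "0 \<le> b" "b \<le> d"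
  shows "(a, b) \<in> A"
  using assms unfolding downset_grid_iff by blast

lemma downset_grid_bounds:
  assumes "downset (grid l n) A" "(a, b) \<in> A"
  shows "0 \<le> a" "a < l" "0 \<le> b" "b < n"
  using subsetD[OF downset_subset[OF assms(1)] assms(2)] by simp_all

lemma downset_grid_finite: "downset (grid l n) A \<Longrightarrow> finite A"
  using finite_subset[OF downset_subset finite_grid] .

lemma optimal_imp_downset:
  "optimal_for_some_weight l n A \<Longrightarrow> downset (grid l n) A"
  unfolding optimal_for_some_weight_def optimal_downset_def by blast

lemma optimal_for_some_weightE:
  assumes "optimal_for_some_weight l n A"
  obtains wt where "rank_increasing (grid l n) wt" "rank_constant (grid l n) wt"
    "downset (grid l n) A"
    "\<And>S. \<lbrakk>downset (grid l n) S; card S = card A\<rbrakk> \<Longrightarrow> sum wt S \<le> sum wt A"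
  using assms unfolding optimal_for_some_weight_def optimal_downset_def by auto

text \<open>Weights do not drop along \<open>f\<close>, so optimality forces equal sums and hence
  equality term by term; as a higher rank weighs strictly more, no rank can rise. The second
  conclusion refutes optimality in \<open>optimal_exchange\<close>.\<close>

lemma optimal_transfer:
  assumes opt: "optimal_for_some_weight l n A" and S: "downset (grid l n) S"
    and f: "bij_betw f A S" and le: "\<And>x. x \<in> A \<Longrightarrow> pair_rank x \<le> pair_rank (f x)"
  shows "optimal_for_some_weight l n S"
    and "\<And>x. x \<in> A \<Longrightarrow> pair_rank (f x) = pair_rank x"
proof -
  obtain wt where inc: "rank_increasing (grid l n) wt" and const: "rank_constant (grid l n) wt"
    and A: "downset (grid l n) A"
    and max: "\<And>S. \<lbrakk>downset (grid l n) S; card S = card A\<rbrakk> \<Longrightarrow> sum wt S \<le> sum wt A"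
    by (rule optimal_for_some_weightE[OF opt]) (rule that)
  have grid: "x \<in> grid l n" "f x \<in> grid l n" if "x \<in> A" for x
    using downset_subset[OF A] downset_subset[OF S] bij_betw_apply[OF f that] that by auto
  have wt_le: "wt x \<le> wt (f x)" if "x \<in> A" for x
    using grid[OF that] le[OF that] inc const
    unfolding rank_increasing_def rank_constant_def by (metis order_le_less)
  have card: "card S = card A"
    using bij_betw_same_card[OF f] by simp
  have sum_f: "sum wt S = (\<Sum>x\<in>A. wt (f x))"
    using sum.reindex_bij_betw[OF f, of wt] by simp
  have eq: "sum wt S = sum wt A"
    using max[OF S card] sum_mono[of A wt "\<lambda>x. wt (f x)"] wt_le sum_f by force
  show "optimal_for_some_weight l n S"
    unfolding optimal_for_some_weight_def optimal_downset_def
    using inc const S max card eq by metis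
  show "pair_rank (f x) = pair_rank x" if "x \<in> A" for x
  proof -
    have "wt x = wt (f x)"
      using sum_mono_inv[of wt A "\<lambda>x. wt (f x)" x] eq sum_f wt_le that downset_grid_finite[OF A]
      by auto
    then show ?thesis
      using grid[OF that] le[OF that] inc unfolding rank_increasing_def
      by (metis order_le_less order_less_irrefl)
  qed
qed

section \<open>Two moves: reflecting a square and exchanging cells\<close>

lemma square_reflection_bij:
  assumes S: "\<And>a b. (a, b) \<in> S \<longleftrightarrow>
      (if s \<le> a \<and> a \<le> s + d \<and> t \<le> b \<and> b \<le> t + d then (s + b - t, t + a - s) \<in> A
       else (a, b) \<in> A)"
  shows "bij_betw (\<lambda>x. if x \<in> packed s (s + d) t (t + d) then reflection s t x else x) A S"
  by (rule bij_betwI[where g = "\<lambda>x. if x \<in> packed s (s + d) t (t + d)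
        then reflection s t x else x"])
    (auto simp: S packed_def reflection_def split: if_splits)

text \<open>The reflection is an involution that keeps \<open>a + b\<close>. The pointwise
  hypothesis says that \<open>S\<close> is the image of \<open>A\<close>, in a form that case
  analysis can check for concrete sets.\<close>

lemma optimal_square_reflection:
  assumes "optimal_for_some_weight l n A" "downset (grid l n) S"
    and "\<And>a b. (a, b) \<in> S \<longleftrightarrow>
      (if s \<le> a \<and> a \<le> s + d \<and> t \<le> b \<and> b \<le> t + d then (s + b - t, t + a - s) \<in> A
       else (a, b) \<in> A)"
  shows "optimal_for_some_weight l n S"
  using optimal_transfer(1)[OF assms(1,2) square_reflection_bij[OF assms(3)]]
  by (auto simp: pair_rank_def reflection_def)

text \<open>Replacing the removable cell \<open>(a, b)\<close> by the addable cell
  \<open>(c, d)\<close> gives a downset of the same size, so the rank cannot rise. The last two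
  hypotheses ensure that \<open>(c, d)\<close> stays addable after the removal.\<close>

lemma optimal_exchange:
  assumes opt: "optimal_for_some_weight l n A"
    and x: "(a, b) \<in> A" "(a + 1, b) \<notin> A" "(a, b + 1) \<notin> A"
    and y: "(c, d) \<notin> A" "0 \<le> c" "c < l" "0 \<le> d" "d < n"
    and y_left: "c = 0 \<or> (c - 1, d) \<in> A" and y_below: "d = 0 \<or> (c, d - 1) \<in> A"
    and "(c - 1, d) \<noteq> (a, b)" "(c, d - 1) \<noteq> (a, b)"
  shows "c + d \<le> a + b"
proof (rule ccontr)
  assume less: "\<not> c + d \<le> a + b"
  note D = optimal_imp_downset[OF opt]
  let ?S = "insert (c, d) (A - {(a, b)})"
  have "downset (grid l n) ?S"
  proof (rule downset_gridI)
    fix p q assume "(p, q) \<in> ?S"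
    then show "0 \<le> p \<and> p < l \<and> 0 \<le> q \<and> q < n"
      using y downset_grid_bounds[OF D] by auto
  next
    fix p q r s assume rs: "(r, s) \<in> ?S" and pq: "0 \<le> p" "p \<le> r" "0 \<le> q" "q \<le> s"
    \<comment> \<open>Both upper neighbours of the removed cell are missing, so nothing in
      \<open>A\<close> lies strictly above it.\<close>
    have maximal: "(u, v) = (a, b)" if "(u, v) \<in> A" "a \<le> u" "b \<le> v" for u v
    proof -
      have "0 \<le> a" "0 \<le> b"
        using downset_grid_bounds[OF D x(1)] by auto
      then have "\<not> a + 1 \<le> u" "\<not> b + 1 \<le> v"
        using x that downset_gridD[OF D that(1), of "a + 1" b]
          downset_gridD[OF D that(1), of a "b + 1"] by auto
      then show ?thesis
        using that by auto
    qed
    show "(p, q) \<in> ?S"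
    proof (cases "(r, s) = (c, d)")
      case False
      then have rsA: "(r, s) \<in> A" "(r, s) \<noteq> (a, b)"
        using rs by auto
      then show ?thesis
        using downset_gridD[OF D rsA(1) pq] maximal[OF rsA(1)] pq by auto
    next
      case True
      show ?thesis
      proof (cases "(p, q) = (c, d)")
        case pq_ne: False
        \<comment> \<open>A cell strictly below the added one lies below its left or its lower
          neighbour, which is in \<open>A\<close> and differs from the removed cell.\<close>
        then consider "p \<le> c - 1" "0 \<le> c - 1" "q \<le> d" | "p \<le> c" "q \<le> d - 1" "0 \<le> d - 1"
          using pq True by force
        then show ?thesis
        proof cases
          case 1
          then have "(c - 1, d) \<in> A" using y_left by auto
          then show ?thesis
            using downset_gridD[OF D _ pq(1) 1(1) pq(3) 1(3)] maximal[of "c - 1" d] assms(12) 1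
            by auto
        next
          case 2
          then have "(c, d - 1) \<in> A" using y_below by auto
          then show ?thesis
            using downset_gridD[OF D _ pq(1) 2(1) pq(3) 2(2)] maximal[of c "d - 1"] assms(13) 2
            by auto
        qed
      qed simp
    qed
  qed
  moreover define f where "f = id((a, b) := (c, d))"
  have "bij_betw f A ?S"
    using x(1) y(1) by (auto simp: f_def bij_betw_def inj_on_def image_iff)
  moreover have "pair_rank z \<le> pair_rank (f z)" for z
    using less by (simp add: f_def pair_rank_def)
  ultimately have "pair_rank (f (a, b)) = pair_rank (a, b)"
    using optimal_transfer(2)[OF opt _ _ _ x(1)] by blast
  then show False
    using less by (simp add: f_def pair_rank_def)
qed

section \<open>Symmetries: exchanging coordinates and complementing\<close>

lemma downset_converse: "downset (grid l n) A \<Longrightarrow> downset (grid n l) (A\<inverse>)"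
  by (rule downset_gridI) (auto dest: downset_grid_bounds intro: downset_gridD)

lemma swap_bij_converse: "bij_betw prod.swap (A\<inverse>) A"
  by (rule bij_betwI[where g = prod.swap]) auto

lemma optimal_converse:
  assumes "optimal_for_some_weight l n A"
  shows "optimal_for_some_weight n l (A\<inverse>)"
proof -
  obtain wt where wt: "rank_increasing (grid l n) wt" "rank_constant (grid l n) wt"
    and A: "downset (grid l n) A"
    and max: "\<And>S. \<lbrakk>downset (grid l n) S; card S = card A\<rbrakk> \<Longrightarrow> sum wt S \<le> sum wt A"
    by (rule optimal_for_some_weightE[OF assms]) (rule that)
  have sum_swap: "sum (wt \<circ> prod.swap) (S\<inverse>) = sum wt S" for S
    using sum.reindex_bij_betw[OF swap_bij_converse, of wt S] by simp
  have "sum (wt \<circ> prod.swap) S \<le> sum (wt \<circ> prod.swap) (A\<inverse>)"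
    if "downset (grid n l) S" "card S = card (A\<inverse>)" for S
    using max[OF downset_converse[OF that(1)]] that(2) sum_swap[of A] sum_swap[of "S\<inverse>"]
    by simp
  moreover have "prod.swap x \<in> grid l n" "pair_rank (prod.swap x) = pair_rank x + 0"
    if "x \<in> grid n l" for x
    using that by (auto simp: grid_def pair_rank_def)
  note rank_increasing_pullback[OF wt(1) this] rank_constant_pullback[OF wt(2) this]
  ultimately show ?thesis
    unfolding optimal_for_some_weight_def optimal_downset_def
    using downset_converse[OF A] by blast
qed

text \<open>The complement of a downset is closed upwards; a half turn of the grid makes it a
  downset again.\<close>

definition rev_compl :: "int \<Rightarrow> int \<Rightarrow> (int \<times> int) set \<Rightarrow> (int \<times> int) set" where
  "rev_compl l n A = {(a, b). (a, b) \<in> grid l n \<and> (l - 1 - a, n - 1 - b) \<notin> A}"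

lemma mem_rev_compl [simp]:
  "(a, b) \<in> rev_compl l n A \<longleftrightarrow> (a, b) \<in> grid l n \<and> (l - 1 - a, n - 1 - b) \<notin> A"
  by (simp add: rev_compl_def)

lemma rev_compl_rev_compl: "A \<subseteq> grid l n \<Longrightarrow> rev_compl l n (rev_compl l n A) = A"
  by (auto simp: rev_compl_def grid_def)

lemma downset_rev_compl: "downset (grid l n) A \<Longrightarrow> downset (grid l n) (rev_compl l n A)"
  by (rule downset_gridI)
    (auto dest: downset_gridD[where a = "l - 1 - c" and b = "n - 1 - d" for c d])

lemma rev_compl_bij:
  "bij_betw (\<lambda>(a, b). (l - 1 - a, n - 1 - b)) (rev_compl l n A) (grid l n - A)"
  by (rule bij_betwI[where g = "\<lambda>(a, b). (l - 1 - a, n - 1 - b)"]) auto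

lemma card_rev_compl:
  assumes "A \<subseteq> grid l n"
  shows "card (rev_compl l n A) = card (grid l n) - card A"
  using bij_betw_same_card[OF rev_compl_bij] assms card_Diff_subset finite_subset[OF assms]
  by (metis finite_grid)

text \<open>The half turn and the sign both reverse comparisons, so \<open>wt'\<close> is rank
  increasing. The sum of \<open>wt'\<close> over \<open>rev_compl l n S\<close> differs from that of
  \<open>wt\<close> over \<open>S\<close> by a constant, so maximizers correspond.\<close>

lemma optimal_rev_compl:
  assumes "optimal_for_some_weight l n A"
  shows "optimal_for_some_weight l n (rev_compl l n A)"
proof -
  obtain wt where wt: "rank_increasing (grid l n) wt" "rank_constant (grid l n) wt"
    and A: "downset (grid l n) A"
    and max: "\<And>S. \<lbrakk>downset (grid l n) S; card S = card A\<rbrakk> \<Longrightarrow> sum wt S \<le> sum wt A"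
    by (rule optimal_for_some_weightE[OF assms]) (rule that)
  define wt' where "wt' = (\<lambda>(a, b). - wt (l - 1 - a, n - 1 - b))"
  have sum_wt': "sum wt' (rev_compl l n S) = sum wt S - sum wt (grid l n)" if "S \<subseteq> grid l n" for S
  proof -
    have "sum wt' (rev_compl l n S)
        = - (\<Sum>x\<in>rev_compl l n S. wt ((\<lambda>(a, b). (l - 1 - a, n - 1 - b)) x))"
      unfolding wt'_def sum_negf[symmetric] by (intro sum.cong) auto
    also have "\<dots> = - sum wt (grid l n - S)"
      using sum.reindex_bij_betw[OF rev_compl_bij, of wt] by simp
    finally show ?thesis
      using sum_diff[OF finite_grid that, of wt] by simp
  qed
  have sub: "A \<subseteq> grid l n"
    by (rule downset_subset[OF A])
  have "sum wt' S \<le> sum wt' (rev_compl l n A)"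
    if "downset (grid l n) S" "card S = card (rev_compl l n A)" for S
  proof -
    have S: "S \<subseteq> grid l n"
      by (rule downset_subset[OF that(1)])
    have "card (rev_compl l n S) = card A"
      using card_rev_compl[OF S] card_rev_compl[OF sub] that(2) card_mono[OF finite_grid sub]
      by simp
    then have "sum wt (rev_compl l n S) \<le> sum wt A"
      using max downset_rev_compl[OF that(1)] by blast
    moreover have "rev_compl l n S \<subseteq> grid l n"
      by (auto simp: rev_compl_def)
    ultimately show ?thesis
      using sum_wt'[OF sub] sum_wt'[of "rev_compl l n S"] rev_compl_rev_compl[OF S] by simp
  qed
  moreover have "rank_increasing (grid l n) wt'"
    unfolding rank_increasing_def
  proof (intro ballI impI)
    fix x y assume "x \<in> grid l n" "y \<in> grid l n" "pair_rank x < pair_rank y"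
    then show "wt' x < wt' y"
      using wt(1)[unfolded rank_increasing_def, rule_format,
          of "(l - 1 - fst y, n - 1 - snd y)" "(l - 1 - fst x, n - 1 - snd x)"]
      by (cases x; cases y) (simp add: wt'_def pair_rank_def)
  qed
  moreover have "rank_constant (grid l n) wt'"
    unfolding rank_constant_def
  proof (intro ballI impI)
    fix x y assume "x \<in> grid l n" "y \<in> grid l n" "pair_rank x = pair_rank y"
    then show "wt' x = wt' y"
      using wt(2)[unfolded rank_constant_def, rule_format,
          of "(l - 1 - fst y, n - 1 - snd y)" "(l - 1 - fst x, n - 1 - snd x)"]
      by (cases x; cases y) (simp add: wt'_def pair_rank_def)
  qed
  ultimately show ?thesis
    unfolding optimal_for_some_weight_def optimal_downset_def
    using downset_rev_compl[OF A] by blast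
qed

section \<open>Removing and restoring a full bottom row\<close>

definition above_bottom :: "(int \<times> int) set \<Rightarrow> (int \<times> int) set" where
  "above_bottom A = {(a, b). 0 \<le> b \<and> (a, b + 1) \<in> A}"

definition on_bottom :: "int \<Rightarrow> (int \<times> int) set \<Rightarrow> (int \<times> int) set" where
  "on_bottom l A = {(a, b). b = 0 \<and> 0 \<le> a \<and> a < l \<or> 0 < b \<and> (a, b - 1) \<in> A}"

lemma on_bottom_above_bottom:
  assumes D: "downset (grid l n) A" and full: "(l - 1, 0) \<in> A"
  shows "on_bottom l (above_bottom A) = A"
proof -
  have "(a, 0) \<in> A" if "0 \<le> a" "a < l" for a
    using downset_gridD[OF D full, of a 0] that by simp
  then show ?thesis
    using downset_grid_bounds[OF D]
    by (auto simp: on_bottom_def above_bottom_def) (metis order_le_less)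
qed

text \<open>A full row put below any downset of the smaller grid contributes a fixed size and a
  fixed weight, so competitors below extend to competitors of \<open>A\<close>. The new weight is
  the old one read one row higher.\<close>

lemma above_bottom_optimal:
  assumes opt: "optimal_for_some_weight l n A" and full: "(l - 1, 0) \<in> A"
  shows "optimal_for_some_weight l (n - 1) (above_bottom A)"
proof -
  obtain wt where wt: "rank_increasing (grid l n) wt" "rank_constant (grid l n) wt"
    and A: "downset (grid l n) A"
    and max: "\<And>S. \<lbrakk>downset (grid l n) S; card S = card A\<rbrakk> \<Longrightarrow> sum wt S \<le> sum wt A"
    by (rule optimal_for_some_weightE[OF opt]) (rule that)
  have pos: "0 < n" "0 < l"
    using downset_grid_bounds[OF A full] by auto
  define row where "row = {0..<l} \<times> {0::int}"
  define up :: "int \<times> int \<Rightarrow> int \<times> int" where "up = (\<lambda>(a, b). (a, b + 1))"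
  have inj: "inj up"
    by (auto simp: up_def inj_def)
  have split: "on_bottom l S = row \<union> up ` S" "row \<inter> up ` S = {}"
    if "downset (grid l (n - 1)) S" for S
    using downset_grid_bounds[OF that]
    by (force simp: on_bottom_def row_def up_def image_iff)+
  have fin: "finite (up ` S)" "finite row" if "downset (grid l (n - 1)) S" for S
    using downset_grid_finite[OF that] by (auto simp: row_def)
  have card_on: "card (on_bottom l S) = card row + card S" if "downset (grid l (n - 1)) S" for S
    using split[OF that] fin[OF that] card_Un_disjoint card_image[OF inj_on_subset[OF inj]]
    by (metis subset_UNIV)
  have sum_on: "sum wt (on_bottom l S) = sum wt row + sum (wt \<circ> up) S"
    if "downset (grid l (n - 1)) S" for S
    using split[OF that] fin[OF that] sum.union_disjoint[of row "up ` S" wt]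
      sum.reindex[OF inj_on_subset[OF inj], of S wt] by simp
  have D_on: "downset (grid l n) (on_bottom l S)" if "downset (grid l (n - 1)) S" for S
  proof (rule downset_gridI)
    fix c d assume "(c, d) \<in> on_bottom l S"
    then show "0 \<le> c \<and> c < l \<and> 0 \<le> d \<and> d < n"
      using downset_grid_bounds[OF that, of c "d - 1"] pos by (auto simp: on_bottom_def)
  next
    fix a b c d assume cd: "(c, d) \<in> on_bottom l S" and ab: "0 \<le> a" "a \<le> c" "0 \<le> b" "b \<le> d"
    show "(a, b) \<in> on_bottom l S"
      using downset_gridD[OF that, of c "d - 1" a "b - 1"] downset_grid_bounds[OF that, of c "d - 1"]
        cd ab by (cases "b = 0") (auto simp: on_bottom_def)
  qed
  have D: "downset (grid l (n - 1)) (above_bottom A)"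
  proof (rule downset_gridI)
    fix c d assume "(c, d) \<in> above_bottom A"
    then show "0 \<le> c \<and> c < l \<and> 0 \<le> d \<and> d < n - 1"
      using downset_grid_bounds[OF A, of c "d + 1"] by (auto simp: above_bottom_def)
  next
    fix a b c d assume "(c, d) \<in> above_bottom A" "0 \<le> a" "a \<le> c" "0 \<le> b" "b \<le> d"
    then show "(a, b) \<in> above_bottom A"
      using downset_gridD[OF A, of c "d + 1" a "b + 1"] by (auto simp: above_bottom_def)
  qed
  note eq = on_bottom_above_bottom[OF A full]
  have "sum (wt \<circ> up) S \<le> sum (wt \<circ> up) (above_bottom A)"
    if "downset (grid l (n - 1)) S" "card S = card (above_bottom A)" for S
    using max[OF D_on[OF that(1)]] card_on[OF that(1)] card_on[OF D] that(2)
      sum_on[OF that(1)] sum_on[OF D] eq by simp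
  moreover have "up x \<in> grid l n" "pair_rank (up x) = pair_rank x + 1"
    if "x \<in> grid l (n - 1)" for x
    using that by (auto simp: up_def grid_def pair_rank_def)
  note rank_increasing_pullback[OF wt(1) this] rank_constant_pullback[OF wt(2) this]
  ultimately show ?thesis
    unfolding optimal_for_some_weight_def optimal_downset_def using D by blast
qed

subsection \<open>Full columns above a full bottom row\<close>

definition rows_and_row :: "int \<Rightarrow> int \<Rightarrow> int \<Rightarrow> int \<Rightarrow> (int \<times> int) set" where
  "rows_and_row l n k m = {(a, b). (a, b) \<in> grid l n \<and> (b < k \<or> b = k \<and> a < m)}"

definition rows_and_column :: "int \<Rightarrow> int \<Rightarrow> int \<Rightarrow> int \<Rightarrow> (int \<times> int) set" where
  "rows_and_column l n k m = {(a, b). (a, b) \<in> grid l n \<and> (b < k \<or> a = 0 \<and> b < k + m)}"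

definition rows_minus_column :: "int \<Rightarrow> int \<Rightarrow> int \<Rightarrow> int \<Rightarrow> (int \<times> int) set" where
  "rows_minus_column l n k m =
     {(a, b). (a, b) \<in> grid l n \<and> b \<le> k \<and> (a = l - 1 \<longrightarrow> b \<le> k - m)}"

text \<open>This is what a full row below a transposed \<open>rows_and_row\<close> looks like: for
  \<open>m \<ge> 0\<close>, column \<open>k\<close> rises \<open>m\<close> cells above row
  0.\<close>

definition bottom_and_columns :: "int \<Rightarrow> int \<Rightarrow> int \<Rightarrow> int \<Rightarrow> (int \<times> int) set" where
  "bottom_and_columns l n k m =
     {(a, b). (a, b) \<in> grid l n \<and> (b = 0 \<or> a < k \<or> a = k \<and> b \<le> m)}"

lemma mem_types [simp]:
  "(a, b) \<in> rows_and_row l n k m \<longleftrightarrow> (a, b) \<in> grid l n \<and> (b < k \<or> b = k \<and> a < m)"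
  "(a, b) \<in> rows_and_column l n k m \<longleftrightarrow> (a, b) \<in> grid l n \<and> (b < k \<or> a = 0 \<and> b < k + m)"
  "(a, b) \<in> rows_minus_column l n k m \<longleftrightarrow>
     (a, b) \<in> grid l n \<and> b \<le> k \<and> (a = l - 1 \<longrightarrow> b \<le> k - m)"
  "(a, b) \<in> bottom_and_columns l n k m \<longleftrightarrow>
     (a, b) \<in> grid l n \<and> (b = 0 \<or> a < k \<or> a = k \<and> b \<le> m)"
  "(a, b) \<in> on_bottom l A \<longleftrightarrow> b = 0 \<and> 0 \<le> a \<and> a < l \<or> 0 < b \<and> (a, b - 1) \<in> A"
  by (simp_all add: rows_and_row_def rows_and_column_def rows_minus_column_def
      bottom_and_columns_def on_bottom_def)

text \<open>Every case outside the conclusion admits a rank-raising exchange, in most cases after a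
  square reflection. The bound on \<open>m\<close> says that column \<open>k\<close> is not
  full.\<close>

lemma optimal_bottom_and_columns:
  assumes opt: "optimal_for_some_weight l n (bottom_and_columns l n k m)"
    and "3 \<le> n" "0 \<le> k" "0 \<le> m" "m \<le> n - 2"
  shows "k = 0 \<and> m \<le> l \<or> k = 1 \<and> m = 0 \<and> n \<le> l \<or> 1 \<le> k \<and> m = 0 \<and> l - k \<le> n - 2 \<or> l \<le> k + 1"
proof -
  consider "l \<le> k + 1" | "k = 0" "m \<le> l" | "k = 1" "m = 0" "n \<le> l"
    | "1 \<le> k" "m = 0" "l - k \<le> n - 2"
    | (tall) "k = 0" "l < m" "2 \<le> l"
    | (wide) "1 \<le> k" "k = 1 \<longrightarrow> 1 \<le> m" "n - 1 \<le> l - k"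
    | (narrow) "1 \<le> k" "1 \<le> m" "l - k \<le> n - 2" "k + 2 \<le> l"
    using assms(2-) by linarith
  then show ?thesis
  proof cases
    \<comment> \<open>The bottom row from column 1 on is turned into column 1. Its top cell, of rank
      \<open>l - 1\<close>, can move onto column 0, at rank \<open>m + 1\<close>.\<close>
    case tall
    define S where "S = {(a, b). (a, b) \<in> grid l n \<and> (a = 0 \<and> b \<le> m \<or> a = 1 \<and> b \<le> l - 2)}"
    have S: "(a, b) \<in> S \<longleftrightarrow> (a, b) \<in> grid l n \<and> (a = 0 \<and> b \<le> m \<or> a = 1 \<and> b \<le> l - 2)" for a b
      by (simp add: S_def)
    have "downset (grid l n) S"
      using tall by (intro downset_gridI) (auto simp: S)
    then have "optimal_for_some_weight l n S"
      by (rule optimal_square_reflection[OF opt, where s = 1 and t = 0 and d = "l - 2"])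
        (use tall assms(2-) in \<open>auto simp: S\<close>)
    from optimal_exchange[OF this, of 1 "l - 2" 0 "m + 1"]
    show ?thesis
      using tall assms(2-) by (simp add: S)
  next
    \<comment> \<open>Columns \<open>k - 1\<close> and \<open>k\<close> above row 0 become rows 1
      and 2. Row 1 now ends inside the grid, and the free place after it has rank
      \<open>k + n - 1\<close>, more than the end of row 2 or, if \<open>m = 0\<close>, the top of
      column \<open>k - 2\<close>.\<close>
    case wide
    define S where "S = {(a, b). (a, b) \<in> grid l n \<and>
      (b = 0 \<or> a < k - 1 \<or> b = 1 \<and> a \<le> k + n - 3 \<or> b = 2 \<and> a \<le> k - 2 + m)}"
    have S: "(a, b) \<in> S \<longleftrightarrow> (a, b) \<in> grid l n \<and>
      (b = 0 \<or> a < k - 1 \<or> b = 1 \<and> a \<le> k + n - 3 \<or> b = 2 \<and> a \<le> k - 2 + m)" for a b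
      by (simp add: S_def)
    have "downset (grid l n) S"
      using wide assms(2-) by (intro downset_gridI) (auto simp: S)
    then have opt_S: "optimal_for_some_weight l n S"
      by (rule optimal_square_reflection[OF opt, where s = "k - 1" and t = 1 and d = "n - 2"])
        (use wide assms(2-) in \<open>auto simp: S\<close>)
    show ?thesis
    proof (cases "m = 0")
      case True
      then show ?thesis
        using optimal_exchange[OF opt_S, of "k - 2" "n - 1" "k + n - 2" 1] wide assms(2-)
        by (simp add: S)
    next
      case False
      then show ?thesis
        using optimal_exchange[OF opt_S, of "k - 2 + m" 2 "k + n - 2" 1] wide assms(2-)
        by (simp add: S)
    qed
  next
    \<comment> \<open>Column \<open>k\<close> and the bottom row from \<open>k\<close> on form a
      hook. Its bottom end moves onto column \<open>k\<close>; if the bottom arm reaches the higher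
      rank, the hook is reflected first.\<close>
    case narrow
    show ?thesis
    proof (cases "l < k + m + 2")
      case True
      then show ?thesis
        using optimal_exchange[OF opt, of "l - 1" 0 k "m + 1"] narrow assms(2-) by simp
    next
      case False
      define S where "S = {(a, b). (a, b) \<in> grid l n \<and>
        (a < k \<or> a = k \<and> b < l - k \<or> b = 0 \<and> a \<le> k + m)}"
      have S: "(a, b) \<in> S \<longleftrightarrow> (a, b) \<in> grid l n \<and>
        (a < k \<or> a = k \<and> b < l - k \<or> b = 0 \<and> a \<le> k + m)" for a b
        by (simp add: S_def)
      have "downset (grid l n) S"
        using narrow assms(2-) by (intro downset_gridI) (auto simp: S)
      then have "optimal_for_some_weight l n S"
        by (rule optimal_square_reflection[OF opt, where s = k and t = 0 and d = "l - k - 1"])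
          (use narrow False assms(2-) in \<open>auto simp: S\<close>)
      from optimal_exchange[OF this, of "k + m" 0 k "l - k"]
      show ?thesis
        using narrow False assms(2-) by (simp add: S)
    qed
  qed (use assms(2-) in auto)
qed

subsection \<open>The families of optimal downsets\<close>

text \<open>The bounds in the last two families make the \<open>m\<close> by \<open>m\<close> square
  that produces them fit into the grid. The first family has no bounds, so the empty set and the
  whole grid are included.\<close>

definition row_type :: "int \<Rightarrow> int \<Rightarrow> (int \<times> int) set \<Rightarrow> bool" where
  "row_type l n A \<longleftrightarrow>
     (\<exists>k m. A = rows_and_row l n k m) \<or>
     (\<exists>k m. A = rows_and_column l n k m \<and> 0 \<le> k \<and> 0 \<le> m \<and> m \<le> l \<and> k + m \<le> n) \<or>
     (\<exists>k m. A = rows_minus_column l n k m \<and> k \<le> n - 1 \<and> 0 \<le> m \<and> m \<le> l \<and> m \<le> k + 1)"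

definition classified :: "int \<Rightarrow> int \<Rightarrow> (int \<times> int) set \<Rightarrow> bool" where
  "classified l n A \<longleftrightarrow> row_type l n A \<or> row_type n l (A\<inverse>)"

lemma row_type_cases [consumes 1, case_names row column notch]:
  assumes "row_type l n A"
  obtains k m where "A = rows_and_row l n k m"
  | k m where "A = rows_and_column l n k m" "0 \<le> k" "0 \<le> m" "m \<le> l" "k + m \<le> n"
  | k m where "A = rows_minus_column l n k m" "k \<le> n - 1" "0 \<le> m" "m \<le> l" "m \<le> k + 1"
  using assms unfolding row_type_def by blast

lemma row_typeI:
  "A = rows_and_row l n k m \<Longrightarrow> row_type l n A"
  "\<lbrakk>A = rows_and_column l n k m; 0 \<le> k; 0 \<le> m; m \<le> l; k + m \<le> n\<rbrakk> \<Longrightarrow> row_type l n A"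
  "\<lbrakk>A = rows_minus_column l n k m; k \<le> n - 1; 0 \<le> m; m \<le> l; m \<le> k + 1\<rbrakk> \<Longrightarrow> row_type l n A"
  unfolding row_type_def by blast+

lemma classifiedI: "row_type l n A \<Longrightarrow> classified l n A" "row_type n l (A\<inverse>) \<Longrightarrow> classified l n A"
  unfolding classified_def by blast+

lemma set_eq_pairsI: "(\<And>a b. (a, b) \<in> A \<longleftrightarrow> (a, b) \<in> B) \<Longrightarrow> A = (B :: (int \<times> int) set)"
  by auto

text \<open>In each family a new full row raises \<open>k\<close> by one.\<close>

lemma row_type_on_bottom:
  assumes "row_type l (n - 1) A" "1 \<le> n"
  shows "row_type l n (on_bottom l A)"
  using assms(1)
proof (cases rule: row_type_cases)
  case (row k m)
  show ?thesis
  proof (cases "0 \<le> k")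
    case True
    have "on_bottom l A = rows_and_row l n (k + 1) m"
      by (rule set_eq_pairsI) (use row True assms(2) in auto)
    then show ?thesis
      by (rule row_typeI)
  next
    \<comment> \<open>A negative \<open>k\<close> describes the empty set, so only the new row
      remains.\<close>
    case False
    have "on_bottom l A = rows_and_row l n 1 0"
      by (rule set_eq_pairsI) (use row False assms(2) in auto)
    then show ?thesis
      by (rule row_typeI)
  qed
next
  case (column k m)
  have "on_bottom l A = rows_and_column l n (k + 1) m"
    by (rule set_eq_pairsI) (use column assms(2) in auto)
  then show ?thesis
    by (rule row_typeI) (use column in auto)
next
  case (notch k m)
  have "on_bottom l A = rows_minus_column l n (k + 1) m"
    by (rule set_eq_pairsI) (use notch assms(2) in auto)
  then show ?thesis
    by (rule row_typeI) (use notch in auto)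
qed

text \<open>The half turn keeps the first family and exchanges the other two.\<close>

lemma row_type_rev_compl:
  assumes "row_type l n A"
  shows "row_type l n (rev_compl l n A)"
  using assms
proof (cases rule: row_type_cases)
  case (row k m)
  have "rev_compl l n A = rows_and_row l n (n - 1 - k) (l - m)"
    by (rule set_eq_pairsI) (use row in auto)
  then show ?thesis
    by (rule row_typeI)
next
  case (column k m)
  have "rev_compl l n A = rows_minus_column l n (n - 1 - k) m"
    by (rule set_eq_pairsI) (use column in auto)
  then show ?thesis
    by (rule row_typeI) (use column in auto)
next
  case (notch k m)
  have "rev_compl l n A = rows_and_column l n (n - 1 - k) m"
    by (rule set_eq_pairsI) (use notch in auto)
  then show ?thesis
    by (rule row_typeI) (use notch in auto)
qed

lemma rev_compl_converse: "(rev_compl l n A)\<inverse> = rev_compl n l (A\<inverse>)"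
  by (rule set_eq_pairsI) auto

lemma classified_rev_compl: "classified l n A \<Longrightarrow> classified l n (rev_compl l n A)"
  unfolding classified_def rev_compl_converse by (blast intro: row_type_rev_compl)

lemma classified_converse: "classified l n A \<Longrightarrow> classified n l (A\<inverse>)"
  unfolding classified_def by auto

lemma classified_bottom_and_columns:
  assumes opt: "optimal_for_some_weight l n (bottom_and_columns l n k m)"
    and "1 \<le> l" "3 \<le> n" "0 \<le> k" "0 \<le> m" "m \<le> n - 2"
  shows "classified l n (bottom_and_columns l n k m)"
proof -
  consider "k = 0" "m \<le> l" | "k = 1" "m = 0" "n \<le> l" | "1 \<le> k" "k < l" "m = 0" "l - k \<le> n - 2"
    | "l \<le> k + 1"
    using optimal_bottom_and_columns[OF opt] assms(2-) by linarith
  then show ?thesis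
  proof cases
    case 1
    have "bottom_and_columns l n k m = rows_and_column l n 1 m"
      by (rule set_eq_pairsI) (use 1 assms(2-) in auto)
    then show ?thesis
      by (intro classifiedI(1), rule row_typeI) (use 1 assms(2-) in auto)
  next
    case 2
    have "bottom_and_columns l n k m = rows_and_column l n 1 (n - 1)"
      by (rule set_eq_pairsI) (use 2 assms(2-) in auto)
    then show ?thesis
      by (intro classifiedI(1), rule row_typeI) (use 2 assms(2-) in auto)
  next
    case 3
    have "(bottom_and_columns l n k m)\<inverse> = rows_and_column n l k (l - k)"
      by (rule set_eq_pairsI) (use 3 assms(2-) in auto)
    then show ?thesis
      by (intro classifiedI(2), rule row_typeI) (use 3 assms(2-) in auto)
  next
    case 4
    \<comment> \<open>The count \<open>m + 1\<close> includes the cell of column \<open>k\<close> in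
      row 0.\<close>
    have "(bottom_and_columns l n k m)\<inverse> = rows_and_row n l k (m + 1)"
      by (rule set_eq_pairsI) (use 4 assms(2-) in auto)
    then show ?thesis
      by (intro classifiedI(2), rule row_typeI)
  qed
qed

section \<open>Full bottom rows below the transposed families\<close>

lemma classified_on_bottom_columns_and_column:
  assumes opt: "optimal_for_some_weight l n (on_bottom l A)"
    and A: "A = (rows_and_row (n - 1) l k m)\<inverse>" and "1 \<le> l" "2 \<le> n"
  shows "classified l n (on_bottom l A)"
proof (cases "n = 2")
  case True
  have "on_bottom l A = rows_and_row l n 1 (if 0 < m then k + 1 else k)"
    by (rule set_eq_pairsI) (use True A in auto)
  then show ?thesis
    by (intro classifiedI(1), rule row_typeI)
next
  case False
  \<comment> \<open>Normalization: for negative \<open>k\<close> the set \<open>A\<close> is empty,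
    a column of \<open>n - 1\<close> cells counts as full, and a negative \<open>m\<close> counts as
    0.\<close>
  define k' where "k' = (if k < 0 then 0 else if n - 1 \<le> m then k + 1 else k)"
  define m' where "m' = (if k < 0 \<or> n - 1 \<le> m \<or> m < 0 then 0 else m)"
  have "on_bottom l A = bottom_and_columns l n k' m'"
    by (rule set_eq_pairsI) (use False A assms(3-) in \<open>auto simp: k'_def m'_def\<close>)
  moreover have "0 \<le> k'" "0 \<le> m'" "m' \<le> n - 2"
    using False assms(4) by (auto simp: k'_def m'_def)
  ultimately show ?thesis
    using classified_bottom_and_columns[of l n k' m'] opt False assms(3-) by simp
qed

text \<open>The partial row, now in row 1, is reflected into column \<open>k\<close>, and
  \<open>optimal_bottom_and_columns\<close> applies to the result.\<close>

lemma classified_on_bottom_columns_and_row: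
  assumes opt: "optimal_for_some_weight l n (on_bottom l A)"
    and opt': "optimal_for_some_weight l (n - 1) A"
    and A: "A = (rows_and_column (n - 1) l k m)\<inverse>"
    and "0 \<le> k" "0 \<le> m" "m \<le> n - 1" "k + m \<le> l" and "1 \<le> l" "2 \<le> n"
  shows "classified l n (on_bottom l A)"
proof -
  consider "n = 2" | "k = 0" | (col) "3 \<le> n" "m \<le> 1" | (refl) "3 \<le> n" "1 \<le> k" "2 \<le> m"
    using assms(4-) by linarith
  then show ?thesis
  proof cases
    case 1
    have "on_bottom l A = rows_and_row l n 1 (k + m)"
      by (rule set_eq_pairsI) (use 1 A assms(4-) in auto)
    then show ?thesis
      by (intro classifiedI(1), rule row_typeI)
  next
    case 2
    have "on_bottom l A = rows_and_row l n 1 m"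
      by (rule set_eq_pairsI) (use 2 A assms(4-) in auto)
    then show ?thesis
      by (intro classifiedI(1), rule row_typeI)
  next
    case col
    have "A = (rows_and_row (n - 1) l k m)\<inverse>"
      by (rule set_eq_pairsI) (use col A assms(4-) in auto)
    then show ?thesis
      using classified_on_bottom_columns_and_column[OF opt] assms(8,9) by blast
  next
    case refl
    define k' m' where "k' = (if m = n - 1 then k + 1 else k)"
      and "m' = (if m = n - 1 then 0 else m)"
    have mem: "(a, b) \<in> on_bottom l A \<longleftrightarrow>
      (a, b) \<in> grid l n \<and> (b = 0 \<or> a < k \<or> b = 1 \<and> a < k + m)" for a b
      using A assms(4-) by auto
    have "downset (grid l n) (bottom_and_columns l n k' m')"
      using refl assms(4-) by (intro downset_gridI) auto
    then have "optimal_for_some_weight l n (bottom_and_columns l n k' m')"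
      by (rule optimal_square_reflection[OF opt, where s = k and t = 1 and d = "m - 1"])
        (unfold mem, use refl assms(4-) in \<open>auto simp: k'_def m'_def\<close>)
    then have "k' = 0 \<and> m' \<le> l \<or> k' = 1 \<and> m' = 0 \<and> n \<le> l \<or>
        1 \<le> k' \<and> m' = 0 \<and> l - k' \<le> n - 2 \<or> l \<le> k' + 1"
      by (rule optimal_bottom_and_columns) (use refl assms(4-) in \<open>auto simp: k'_def m'_def\<close>)
    \<comment> \<open>So the reflected cells fill column \<open>k\<close>, and row 1 was full before
      the reflection.\<close>
    then have special: "m = n - 1" "l = k + n - 1"
      using refl assms(4-) by (auto simp: k'_def m'_def split: if_splits)
    show ?thesis
    proof (cases "n = 3")
      case True
      have "on_bottom l A = rows_and_row l n 2 k"
        by (rule set_eq_pairsI) (unfold mem, use True special assms(4-) in auto)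
      then show ?thesis
        by (intro classifiedI(1), rule row_typeI)
    next
      case False
      \<comment> \<open>Now \<open>A\<close> itself is a full row with full columns, in a grid of
        height at least 3, and its own optimality leaves one column only.\<close>
      have "A = bottom_and_columns l (n - 1) k 0"
        by (rule set_eq_pairsI) (use special A assms(4-) in auto)
      then have "k = 1"
        using optimal_bottom_and_columns[of l "n - 1" k 0] opt' False special refl by auto
      then have "on_bottom l A = rows_and_column l n 2 (n - 2)"
        by (intro set_eq_pairsI, unfold mem) (use special assms(4-) in auto)
      then show ?thesis
        by (intro classifiedI(1), rule row_typeI) (use special refl in auto)
    qed
  qed
qed

text \<open>In the main case the gap in the top row is reflected into column \<open>k\<close>. Then
  \<open>optimal_bottom_and_columns\<close> forces \<open>m = n - 1\<close>, and few shapes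
  remain.\<close>

lemma classified_on_bottom_columns_minus_row:
  assumes opt: "optimal_for_some_weight l n (on_bottom l A)"
    and A: "A = (rows_minus_column (n - 1) l k m)\<inverse>"
    and "k \<le> l - 1" "0 \<le> m" "m \<le> n - 1" "m \<le> k + 1" and "1 \<le> l" "2 \<le> n"
  shows "classified l n (on_bottom l A)"
proof -
  have mem: "(a, b) \<in> on_bottom l A \<longleftrightarrow>
      (a, b) \<in> grid l n \<and> (b = 0 \<or> a \<le> k \<and> (b = n - 1 \<longrightarrow> a \<le> k - m))" for a b
    using A assms(3-) by auto
  consider "n = 2" | (col) "m = 0" | (wide) "l = k + 1"
    | (col') "k \<le> 0" "m \<noteq> 0" | (refl) "3 \<le> n" "1 \<le> m" "1 \<le> k" "k + 2 \<le> l"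
    using assms(3-) by linarith
  then show ?thesis
  proof cases
    case 1
    have "on_bottom l A = rows_and_row l n 1 (k - m + 1)"
      by (rule set_eq_pairsI) (unfold mem, use 1 assms(3-) in auto)
    then show ?thesis
      by (intro classifiedI(1), rule row_typeI)
  next
    case col
    have "A = (rows_and_row (n - 1) l (k + 1) 0)\<inverse>"
      by (rule set_eq_pairsI) (use col A assms(3-) in auto)
    then show ?thesis
      using classified_on_bottom_columns_and_column[OF opt] assms(7,8) by blast
  next
    case wide
    have "on_bottom l A = rows_and_row l n (n - 1) (k - m + 1)"
      by (rule set_eq_pairsI) (unfold mem, use wide assms(3-) in auto)
    then show ?thesis
      by (intro classifiedI(1), rule row_typeI)
  next
    case col'
    have "A = (rows_and_row (n - 1) l 0 (n - 2))\<inverse>"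
      by (rule set_eq_pairsI) (use col' A assms(3-) in auto)
    then show ?thesis
      using classified_on_bottom_columns_and_column[OF opt] assms(7,8) by blast
  next
    case refl
    have "downset (grid l n) (bottom_and_columns l n k (n - 1 - m))"
      using refl assms(3-) by (intro downset_gridI) auto
    then have "optimal_for_some_weight l n (bottom_and_columns l n k (n - 1 - m))"
      by (rule optimal_square_reflection[OF opt,
            where s = "k - m + 1" and t = "n - m" and d = "m - 1"])
        (unfold mem, use refl assms(3-) in auto)
    then have "k = 0 \<and> n - 1 - m \<le> l \<or> k = 1 \<and> n - 1 - m = 0 \<and> n \<le> l \<or>
        1 \<le> k \<and> n - 1 - m = 0 \<and> l - k \<le> n - 2 \<or> l \<le> k + 1"
      by (rule optimal_bottom_and_columns) (use refl assms(3-) in auto)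
    then have m: "m = n - 1" and kl: "k = 1 \<and> n \<le> l \<or> l - k \<le> n - 2"
      using refl by auto
    \<comment> \<open>From \<open>m = n - 1\<close> and \<open>m \<le> k + 1\<close> follows
      \<open>n - 2 \<le> k\<close>; if equality holds, the top row is empty.\<close>
    consider "k = 1" "n = 3" | "4 \<le> n" "l - k \<le> n - 2" "n - 1 \<le> k"
      | "4 \<le> n" "k = n - 2" "l = n" | "4 \<le> n" "k = n - 2" "n + 1 \<le> l"
      using kl m refl assms(3-) by linarith
    then show ?thesis
    proof cases
      case 1
      have "on_bottom l A = rows_and_row l n 1 2"
        by (rule set_eq_pairsI) (unfold mem, use 1 m assms(3-) in auto)
      then show ?thesis
        by (intro classifiedI(1), rule row_typeI)
    next
      \<comment> \<open>The last cell of the top row has rank \<open>k\<close>, the free place after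
        row 1 has rank \<open>k + 2\<close>.\<close>
      case 2
      show ?thesis
        using optimal_exchange[OF opt, of "k + 1 - n" "n - 1" "k + 1" 1] 2 m refl assms(3-)
        by (simp add: mem del: mem_types)
    next
      case 3
      have "on_bottom l A = rows_minus_column l n (n - 2) (n - 2)"
        by (rule set_eq_pairsI) (unfold mem, use 3 m assms(3-) in auto)
      then show ?thesis
        by (intro classifiedI(1), rule row_typeI) (use 3 in auto)
    next
      \<comment> \<open>The set is a square of side \<open>n - 1\<close> whose bottom row sticks out
        by at least two cells. The reflection trades the empty part of column \<open>n - 1\<close>
        for a gap in row \<open>n - 2\<close>; then \<open>(1, n - 2)\<close> can move to
        \<open>(n, 1)\<close>, two ranks higher.\<close>
      case 4
      define S where "S = {(a, b). (a, b) \<in> grid l n \<and>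
        (b = 0 \<or> b \<le> n - 3 \<and> a \<le> n - 1 \<or> b = n - 2 \<and> a \<le> 1)}"
      have S: "(a, b) \<in> S \<longleftrightarrow> (a, b) \<in> grid l n \<and>
        (b = 0 \<or> b \<le> n - 3 \<and> a \<le> n - 1 \<or> b = n - 2 \<and> a \<le> 1)" for a b
        by (simp add: S_def)
      have "downset (grid l n) S"
        using 4 by (intro downset_gridI) (auto simp: S)
      then have "optimal_for_some_weight l n S"
        by (rule optimal_square_reflection[OF opt, where s = 2 and t = 1 and d = "n - 3"])
          (unfold mem, use 4 m assms(3-) in \<open>auto simp: S\<close>)
      from optimal_exchange[OF this, of 1 "n - 2" n 1]
      show ?thesis
        using 4 by (simp add: S)
    qed
  qed
qed

section \<open>The induction on the size of the grid\<close>

lemma classified_if_bottom_full: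
  assumes opt: "optimal_for_some_weight l n A" and full: "(l - 1, 0) \<in> A"
    and IH: "2 \<le> n \<Longrightarrow> classified l (n - 1) (above_bottom A)"
  shows "classified l n A"
proof -
  note D = optimal_imp_downset[OF opt]
  note eq = on_bottom_above_bottom[OF D full]
  have pos: "1 \<le> l" "1 \<le> n"
    using downset_grid_bounds[OF D full] by auto
  show ?thesis
  proof (cases "n = 1")
    case True
    have "A = rows_and_row l n 1 0"
    proof (rule set_eq_pairsI)
      show "(a, b) \<in> A \<longleftrightarrow> (a, b) \<in> rows_and_row l n 1 0" for a b
        using downset_grid_bounds[OF D, of a b] downset_gridD[OF D full, of a b] True
        by (cases "b = 0") auto
    qed
    then show ?thesis
      by (intro classifiedI(1), rule row_typeI)
  next
    case False
    then have n: "2 \<le> n"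
      using pos by simp
    note opt' = above_bottom_optimal[OF opt full]
    have opt_eq: "optimal_for_some_weight l n (on_bottom l (above_bottom A))"
      using opt eq by simp
    from IH[OF n] consider "row_type l (n - 1) (above_bottom A)"
      | "row_type (n - 1) l ((above_bottom A)\<inverse>)"
      unfolding classified_def by blast
    then show ?thesis
    proof cases
      case 1
      then show ?thesis
        using row_type_on_bottom pos(2) eq classifiedI(1) by metis
    next
      case 2
      then show ?thesis
      proof (cases rule: row_type_cases)
        case (row k m)
        then have "above_bottom A = (rows_and_row (n - 1) l k m)\<inverse>"
          by (metis converse_converse)
        from classified_on_bottom_columns_and_column[OF opt_eq this pos(1) n] show ?thesis
          by (simp add: eq)
      next
        case (column k m)
        then have "above_bottom A = (rows_and_column (n - 1) l k m)\<inverse>"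
          by (metis converse_converse)
        from classified_on_bottom_columns_and_row[OF opt_eq opt' this column(2-) pos(1) n]
        show ?thesis
          by (simp add: eq)
      next
        case (notch k m)
        then have "above_bottom A = (rows_minus_column (n - 1) l k m)\<inverse>"
          by (metis converse_converse)
        from classified_on_bottom_columns_minus_row[OF opt_eq this notch(2-) pos(1) n]
        show ?thesis
          by (simp add: eq)
      qed
    qed
  qed
qed

lemma optimal_imp_classified:
  assumes "optimal_for_some_weight l n A" "1 \<le> l" "1 \<le> n"
  shows "classified l n A"
  using assms
proof (induction "nat (l + n)" arbitrary: l n A rule: less_induct)
  case less
  \<comment> \<open>Stated for every grid with the same \<open>l + n\<close>, since it is also
    applied after exchanging the coordinates.\<close>
  have bottom: "classified l' n' B"
    if "optimal_for_some_weight l' n' B" "(l' - 1, 0) \<in> B" "l' + n' = l + n" "1 \<le> l'" for l' n' B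
  proof (rule classified_if_bottom_full[OF that(1,2)])
    assume "2 \<le> n'"
    with less.prems that show "classified l' (n' - 1) (above_bottom B)"
      by (intro less.hyps above_bottom_optimal) auto
  qed
  show ?case
  proof (cases "(l - 1, 0) \<in> A")
    case True
    then show ?thesis
      using bottom less.prems by blast
  next
    case False
    \<comment> \<open>As the corner \<open>(l - 1, 0)\<close> is missing from \<open>A\<close>, the
      corner \<open>(0, n - 1)\<close> lies in \<open>rev_compl l n A\<close>; exchanging
      coordinates makes it the end of a full bottom row.\<close>
    define B where "B = (rev_compl l n A)\<inverse>"
    note D = optimal_imp_downset[OF less.prems(1)]
    have "(n - 1, 0) \<in> B"
      using False less.prems by (simp add: B_def)
    moreover have "optimal_for_some_weight n l B"
      unfolding B_def by (intro optimal_converse optimal_rev_compl less.prems)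
    ultimately have "classified n l B"
      using bottom less.prems by (simp add: add.commute)
    then have "classified l n (rev_compl l n (B\<inverse>))"
      by (intro classified_rev_compl classified_converse)
    then show ?thesis
      by (simp add: B_def rev_compl_rev_compl[OF downset_subset[OF D]])
  qed
qed

subsection \<open>Initial segments and symmetrization\<close>

text \<open>The predecessors of an element of \<open>A\<close> lie in \<open>A\<close> without that
  element, and an element outside \<open>A\<close> is preceded by all of \<open>A\<close>.\<close>

lemma initial_segment_card:
  assumes "finite M" "A \<subseteq> M"
    and closed: "\<And>x y. \<lbrakk>x \<in> A; y \<in> M; D y x\<rbrakk> \<Longrightarrow> y \<in> A"
    and irrefl: "\<And>x. \<not> D x x" and total: "\<And>x y. x \<noteq> y \<Longrightarrow> D x y \<or> D y x"
  shows "initial_segment M D (card A) = A"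
proof -
  have fin: "finite A"
    using assms(1,2) finite_subset by blast
  have "card {y \<in> M. D y x} < card A" if "x \<in> A" for x
    using closed[OF that] irrefl that by (intro psubset_card_mono[OF fin]) blast
  moreover have "card A \<le> card {y \<in> M. D y x}" if "x \<in> M" "x \<notin> A" for x
  proof (rule card_mono)
    show "A \<subseteq> {y \<in> M. D y x}"
    proof
      fix y assume y: "y \<in> A"
      then have "D x y \<or> D y x"
        using that(2) by (intro total) auto
      then show "y \<in> {y \<in> M. D y x}"
        using closed[OF y that(1)] that(2) y assms(2) by auto
    qed
  qed (use assms(1) in simp)
  ultimately show ?thesis
    using assms(2) unfolding initial_segment_def by (fastforce simp: subset_iff)
qed

lemma initial_segment_colex:
  "initial_segment (grid l n) colex_less (card (rows_and_row l n k m)) = rows_and_row l n k m"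
proof (rule initial_segment_card)
  show "y \<in> rows_and_row l n k m"
    if "x \<in> rows_and_row l n k m" "y \<in> grid l n" "colex_less y x" for x y
    using that by (cases x; cases y) (auto simp: colex_less_def)
qed (auto simp: colex_less_def rows_and_row_def)

lemma initial_segment_lex:
  "initial_segment (grid l n) lex_less (card ((rows_and_row n l k m)\<inverse>)) = (rows_and_row n l k m)\<inverse>"
proof (rule initial_segment_card)
  show "y \<in> (rows_and_row n l k m)\<inverse>"
    if "x \<in> (rows_and_row n l k m)\<inverse>" "y \<in> grid l n" "lex_less y x" for x y
    using that by (cases x; cases y) (auto simp: lex_less_def)
qed (auto simp: lex_less_def rows_and_row_def)

text \<open>A mirror pair inside \<open>A\<close> is kept; from a pair with one cell in
  \<open>A\<close>, the cell on the side of the diagonal where local coordinate \<open>c1\<close> is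
  the larger survives.\<close>

lemma mem_Sym:
  assumes c: "c1 = 1 \<and> c2 = 2 \<or> c1 = 2 \<and> c2 = 1"
  shows "(a, b) \<in> Sym s (s + d) t (t + d) A c1 c2 \<longleftrightarrow>
     (if s \<le> a \<and> a \<le> s + d \<and> t \<le> b \<and> b \<le> t + d
      then (a, b) \<in> A \<and> (s + b - t, t + a - s) \<in> A \<or>
           local_coord s t c2 (a, b) \<le> local_coord s t c1 (a, b) \<and>
             ((a, b) \<in> A \<or> (s + b - t, t + a - s) \<in> A)
      else (a, b) \<in> A)"
proof -
  let ?Q = "packed s (s + d) t (t + d)"
  have "(a, b) \<in> sym_elem s t c1 c2 ` (A \<inter> ?Q) \<longleftrightarrow>
      (a, b) \<in> ?Q \<and> local_coord s t c2 (a, b) \<le> local_coord s t c1 (a, b) \<and>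
        ((a, b) \<in> A \<or> (s + b - t, t + a - s) \<in> A)" (is "?I \<longleftrightarrow> ?J")
  proof
    assume ?I
    then show ?J
      using c by (auto simp: sym_elem_def local_coord_def reflection_def packed_def
          split: if_splits)
  next
    assume J: ?J
    have "(a, b) = sym_elem s t c1 c2 (a, b)"
      using J by (auto simp: sym_elem_def)
    moreover have "(a, b) = sym_elem s t c1 c2 (s + b - t, t + a - s)"
      using J c by (auto simp: sym_elem_def local_coord_def reflection_def)
    moreover have "(s + b - t, t + a - s) \<in> ?Q"
      using J by (auto simp: packed_def)
    ultimately show ?I
      using J by blast
  qed
  then show ?thesis
    using c by (auto simp: Sym_def reflection_def packed_def)
qed

lemma mem_Sym_2_1:
  "(a, b) \<in> Sym s (s + d) t (t + d) A 2 1 \<longleftrightarrow>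
     (if s \<le> a \<and> a \<le> s + d \<and> t \<le> b \<and> b \<le> t + d
      then (a, b) \<in> A \<and> (s + b - t, t + a - s) \<in> A \<or>
           a - s \<le> b - t \<and> ((a, b) \<in> A \<or> (s + b - t, t + a - s) \<in> A)
      else (a, b) \<in> A)"
  by (subst mem_Sym) (simp_all add: local_coord_def)

lemma Sym_converse:
  "(Sym s (s + d) t (t + d) A 2 1)\<inverse> = Sym t (t + d) s (s + d) (A\<inverse>) 1 2"
proof (rule set_eq_pairsI)
  show "(a, b) \<in> (Sym s (s + d) t (t + d) A 2 1)\<inverse> \<longleftrightarrow>
      (a, b) \<in> Sym t (t + d) s (s + d) (A\<inverse>) 1 2" for a b
    unfolding converse_iff by (subst (1 2) mem_Sym) (auto simp: local_coord_def)
qed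

text \<open>With the pair 2, 1, cells are pushed above the diagonal: the partial row becomes part of
  column 0, or the gap at the end of row \<open>k\<close> becomes a gap in the last column. Both
  agree with reflecting the whole square, a bijection that gives the cardinality.\<close>

lemma row_type_imp_Sym:
  assumes "row_type l n A"
  obtains k m s t d where "packed s (s + d) t (t + d) \<subseteq> grid l n"
    "A = Sym s (s + d) t (t + d) (rows_and_row l n k m) 2 1"
    "card (rows_and_row l n k m) = card A"
  using assms
proof (cases rule: row_type_cases)
  case (row k m)
  \<comment> \<open>With \<open>d = - 1\<close> the square is empty and symmetrizing changes
    nothing.\<close>
  have A: "A = Sym 0 (0 + - 1) 0 (0 + - 1) (rows_and_row l n k m) 2 1"
    by (rule set_eq_pairsI, unfold mem_Sym_2_1) (auto simp: row)
  have Q: "packed 0 (0 + - 1) 0 (0 + - 1) \<subseteq> grid l n"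
    by (auto simp: packed_def)
  show ?thesis
    using row by (intro that[OF Q A]) simp
next
  case (column k m)
  have "bij_betw (\<lambda>x. if x \<in> packed 0 (0 + (m - 1)) k (k + (m - 1)) then reflection 0 k x else x)
      (rows_and_row l n k m) A"
    by (rule square_reflection_bij) (use column in auto)
  from bij_betw_same_card[OF this]
  have card: "card (rows_and_row l n k m) = card A" .
  have A: "A = Sym 0 (0 + (m - 1)) k (k + (m - 1)) (rows_and_row l n k m) 2 1"
    by (rule set_eq_pairsI, unfold mem_Sym_2_1) (use column in auto)
  have Q: "packed 0 (0 + (m - 1)) k (k + (m - 1)) \<subseteq> grid l n"
    using column by (auto simp: packed_def)
  show ?thesis
    by (rule that[OF Q A card])
next
  case (notch k m)
  let ?s = "l - m" and ?t = "k - m + 1"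
  have "bij_betw (\<lambda>x. if x \<in> packed ?s (?s + (m - 1)) ?t (?t + (m - 1))
      then reflection ?s ?t x else x) (rows_and_row l n k (l - m)) A"
    by (rule square_reflection_bij) (use notch in auto)
  from bij_betw_same_card[OF this]
  have card: "card (rows_and_row l n k (l - m)) = card A" .
  have A: "A = Sym ?s (?s + (m - 1)) ?t (?t + (m - 1)) (rows_and_row l n k (l - m)) 2 1"
    by (rule set_eq_pairsI, unfold mem_Sym_2_1) (use notch in auto)
  have Q: "packed ?s (?s + (m - 1)) ?t (?t + (m - 1)) \<subseteq> grid l n"
    using notch by (auto simp: packed_def)
  show ?thesis
    by (rule that[OF Q A card])
qed

lemma card_converse: "card (A\<inverse>) = card (A :: (int \<times> int) set)"
  by (rule bij_betw_same_card[OF swap_bij_converse])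

theorem theorem3p12:
  fixes l1 l2 :: int
    and wt :: "int \<times> int \<Rightarrow> real"
    and A :: "(int \<times> int) set"
  assumes "l1 \<ge> 1" and "l2 \<ge> 1"
    and "rank_increasing (grid l1 l2) wt"
    and "rank_constant (grid l1 l2) wt"
    and "optimal_downset (grid l1 l2) wt A"
  shows "(\<exists>D\<in>domination_orders. A = initial_segment (grid l1 l2) D (card A)) \<or>
    (\<exists>D\<in>domination_orders. \<exists>s1 t1 s2 t2. \<exists>c1\<in>{1, 2}. \<exists>c2\<in>{1, 2}.
       packed s1 t1 s2 t2 \<subseteq> grid l1 l2 \<and>
       (c1 \<noteq> c2 \<longrightarrow> t1 - s1 = t2 - s2) \<and>
       A = Sym s1 t1 s2 t2 (initial_segment (grid l1 l2) D (card A)) c1 c2)"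
proof -
  have "optimal_for_some_weight l1 l2 A"
    using assms(3-5) unfolding optimal_for_some_weight_def by blast
  then have "classified l1 l2 A"
    using assms(1,2) by (rule optimal_imp_classified)
  then consider "row_type l1 l2 A" | "row_type l2 l1 (A\<inverse>)"
    unfolding classified_def by blast
  \<comment> \<open>The second alternative is shown in all cases; an initial segment itself is
    reached through an empty square.\<close>
  then have "\<exists>D\<in>domination_orders. \<exists>s1 t1 s2 t2. \<exists>c1\<in>{1, 2}. \<exists>c2\<in>{1, 2}.
       packed s1 t1 s2 t2 \<subseteq> grid l1 l2 \<and> (c1 \<noteq> c2 \<longrightarrow> t1 - s1 = t2 - s2) \<and>
       A = Sym s1 t1 s2 t2 (initial_segment (grid l1 l2) D (card A)) c1 c2"
  proof cases
    case 1
    then obtain k m s t d where Q: "packed s (s + d) t (t + d) \<subseteq> grid l1 l2"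
      and A: "A = Sym s (s + d) t (t + d) (rows_and_row l1 l2 k m) 2 1"
      and card: "card (rows_and_row l1 l2 k m) = card A"
      by (rule row_type_imp_Sym)
    have I: "initial_segment (grid l1 l2) colex_less (card A) = rows_and_row l1 l2 k m"
      using initial_segment_colex[of l1 l2 k m] card by simp
    show ?thesis
    proof (intro bexI exI conjI impI)
      show "packed s (s + d) t (t + d) \<subseteq> grid l1 l2"
        by (rule Q)
      show "s + d - s = t + d - t"
        by simp
      show "A = Sym s (s + d) t (t + d) (initial_segment (grid l1 l2) colex_less (card A)) 2 1"
        unfolding I by (rule A)
    qed (simp_all add: domination_orders_def)
  next
    \<comment> \<open>Exchanging the coordinates back turns the colexicographic segment into a
      lexicographic one and the pair 2, 1 into 1, 2.\<close>
    case 2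
    then obtain k m s t d where Q: "packed s (s + d) t (t + d) \<subseteq> grid l2 l1"
      and A: "A\<inverse> = Sym s (s + d) t (t + d) (rows_and_row l2 l1 k m) 2 1"
      and card: "card (rows_and_row l2 l1 k m) = card (A\<inverse>)"
      by (rule row_type_imp_Sym)
    have I: "initial_segment (grid l1 l2) lex_less (card A) = (rows_and_row l2 l1 k m)\<inverse>"
      using initial_segment_lex[of l1 l2 k m] card by (simp add: card_converse)
    show ?thesis
    proof (intro bexI exI conjI impI)
      show "packed t (t + d) s (s + d) \<subseteq> grid l1 l2"
        using Q by (auto simp: packed_def grid_def)
      show "t + d - t = s + d - s"
        by simp
      show "A = Sym t (t + d) s (s + d) (initial_segment (grid l1 l2) lex_less (card A)) 1 2"
        unfolding I Sym_converse[symmetric] A[symmetric] by simp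
    qed (simp_all add: domination_orders_def)
  qed
  then show ?thesis
    by (rule disjI2)
qed

end
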